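(* Let $P$ be a Markov transition kernel on a finite state space $S$ with $|S|\ge 2$ and with a stationary distribution $\pi$ of full support. For any probability distribution $\mu\neq\pi$ on $S$, $$\frac{D_{\mathrm{KL}}(\mu P\|\pi)}{D_{\mathrm{KL}}(\mu\|\pi)}\;\le\;M\cdot\frac{D_{\mathrm{KL}}(\mu\|\pi)+H(\mu)}{D_{\mathrm{KL}}(\mu\|\pi)}\;-\;\frac{I_\mu(X;Y)}{D_{\mathrm{KL}}(\mu\|\pi)},$$ where $H(\mu)=-\sum_x\mu(x)\log\mu(x)$ is the Shannon entropy. Equality holds if and only if $r(x)=M$ for all $x$ in the support of $\mu$.
   Context: All logarithms are natural, with $0\log 0=0$. For probability measures $\mu,\nu$ on $S$, $D_{\mathrm{KL}}(\mu\|\nu)=\sum_{x\in S}\mu(x)\log\frac{\mu(x)}{\nu(x)}$. $(\mu P)(y)=\sum_x\mu(x)P(x,y)$. The local KL retention ratio is $r(x):=D_{\mathrm{KL}}(P(x,\cdot)\|\pi)/\log(1/\pi(x))$ for $x\in S$, and $M:=\max_{x\in S}r(x)$. The mutual information is $I_\mu(X;Y):=\sum_{x\in S}\mu(x)\,D_{\mathrm{KL}}(P(x,\cdot)\|\mu P)$ (for $X\sim\mu$, $Y\mid X=x\sim P(x,\cdot)$). *)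

theory Defs
  imports "HOL-Probability.Probability"
begin

(* Probability measures on a finite state space are pmfs over a finite type; a transition kernel
   is a map P :: 'a => 'a pmf, and the law mu P is bind_pmf mu P. *)

(* Real-valued, with the conventions 0 log 0 = 0 and 0 log (0/0) = 0 supplied by ln 0 = 0.
   It has the intended meaning only if p is absolutely continuous with respect to q: a term with
   p x > 0 = q x, which ought to be infinite, contributes 0. *)
definition KL :: "'a::finite pmf \<Rightarrow> 'a pmf \<Rightarrow> real" where
  "KL p q = (\<Sum>x\<in>UNIV. pmf p x * ln (pmf p x / pmf q x))"

lemma KL_eq_KL_divergence:
  fixes p q :: "'a::finite pmf"
  assumes "set_pmf p \<subseteq> set_pmf q"
  shows "KL p q = KL_divergence (exp 1) (measure_pmf q) (measure_pmf p)"
proof -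
  interpret sigma_finite_measure "count_space (UNIV :: 'a set)"
    by (rule sigma_finite_measure_count_space_finite) simp
  have ac: "pmf q x = 0 \<longrightarrow> pmf p x = 0" for x
    using assms by (auto simp: set_pmf_iff)
  have d: "measure_pmf r = density (count_space UNIV) (\<lambda>x. ennreal (pmf r x))"
    for r :: "'a pmf"
    by (metis measure_pmf_eq_density)
  have "KL_divergence (exp 1) (measure_pmf q) (measure_pmf p)
        = (\<integral>x. pmf p x * log (exp 1) (pmf p x / pmf q x) \<partial>count_space UNIV)"
    unfolding d by (rule KL_density_density) (simp_all add: ac)
  then show ?thesis
    by (simp add: KL_def lebesgue_integral_count_space_finite log_def)
qed

definition shannon_entropy :: "'a::finite pmf \<Rightarrow> real" where
  "shannon_entropy p = - (\<Sum>x\<in>UNIV. pmf p x * ln (pmf p x))"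

definition kl_retention :: "('a::finite \<Rightarrow> 'a pmf) \<Rightarrow> 'a pmf \<Rightarrow> 'a \<Rightarrow> real" where
  "kl_retention P \<pi> x = KL (P x) \<pi> / ln (1 / pmf \<pi> x)"

definition max_kl_retention :: "('a::finite \<Rightarrow> 'a pmf) \<Rightarrow> 'a pmf \<Rightarrow> real" where
  "max_kl_retention P \<pi> = (MAX x. kl_retention P \<pi> x)"

(* P x need not be absolutely continuous with respect to bind_pmf mu P when pmf mu x = 0; such x
   carry weight 0, so the value assigned to KL there is irrelevant. For pmf mu x > 0 absolute
   continuity holds, since the law of Y dominates P x. *)
definition mutual_info :: "'a::finite pmf \<Rightarrow> ('a \<Rightarrow> 'a pmf) \<Rightarrow> real" where
  "mutual_info \<mu> P = (\<Sum>x\<in>UNIV. pmf \<mu> x * KL (P x) (bind_pmf \<mu> P))"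

end

theory Submission
  imports Defs
begin

text \<open>
  The chain rule for relative entropy gives
  \<open>D(\<mu>P \<parallel> \<pi>) + I\<^sub>\<mu>(X;Y) = \<Sum>x. \<mu>(x) D(P(x,\<cdot>) \<parallel> \<pi>) = \<Sum>x. \<mu>(x) r(x) log (1/\<pi>(x))\<close>, while
  \<open>D(\<mu> \<parallel> \<pi>) + H(\<mu>) = \<Sum>x. \<mu>(x) log (1/\<pi>(x))\<close>. So the two sides of the claim, multiplied by
  \<open>D(\<mu> \<parallel> \<pi>) > 0\<close>, differ by \<open>\<Sum>x. \<mu>(x) log (1/\<pi>(x)) (M - r(x))\<close>, a sum of nonnegative terms
  that vanishes iff \<open>r = M\<close> on the support of \<open>\<mu>\<close>.
\<close>

lemma pmf_bind_finite:
  fixes \<mu> :: "'a::finite pmf"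
  shows "pmf (bind_pmf \<mu> P) y = (\<Sum>x\<in>UNIV. pmf \<mu> x * pmf (P x) y)"
  unfolding pmf_bind
  by (subst integral_measure_pmf[of UNIV]) (auto simp: mult.commute)

lemma sum_pmf_UNIV: "(\<Sum>x\<in>UNIV. pmf p x) = 1" for p :: "'a::finite pmf"
  by (rule sum_pmf_eq_1) auto

text \<open>Strict Gibbs inequality: each term of \<open>KL p q\<close> is at least
  \<open>pmf p x - pmf q x\<close>, strictly so wherever \<open>p\<close> and \<open>q\<close>
  differ, and these lower bounds sum to 0.\<close>

lemma KL_pos:
  fixes p q :: "'a::finite pmf"
  assumes q: "set_pmf q = UNIV" and "p \<noteq> q"
  shows "KL p q > 0"
proof -
  have qpos: "pmf q x > 0" for x
    using q by (simp add: pmf_positive)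
  have strict: "pmf p x - pmf q x < pmf p x * ln (pmf p x / pmf q x)"
    if ne: "pmf p x \<noteq> pmf q x" for x
  proof (cases "pmf p x = 0")
    case True
    then show ?thesis using qpos[of x] by simp
  next
    case False
    then have pp: "pmf p x > 0" by (simp add: pmf_nonneg order_less_le)
    \<comment> \<open>The ratio is inverted so that the upper bound \<open>ln t < t - 1\<close>
      turns into a lower bound for \<open>- ln t\<close>.\<close>
    define t where "t = pmf q x / pmf p x"
    have t: "t > 0" "t \<noteq> 1" using pp qpos[of x] ne by (auto simp: t_def)
    then have "ln t < t - 1"
      using ln_le_minus_one[of t] ln_eq_minus_one[of t] by linarith
    then have "pmf p x * ln t < pmf p x * (t - 1)" using pp by simp
    moreover have "pmf p x * (t - 1) = pmf q x - pmf p x"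
      using pp by (simp add: t_def field_simps)
    moreover have "pmf p x * ln (pmf p x / pmf q x) = - (pmf p x * ln t)"
      using pp qpos[of x] by (simp add: t_def ln_div algebra_simps)
    ultimately show ?thesis by linarith
  qed
  obtain x where "pmf p x \<noteq> pmf q x"
    using \<open>p \<noteq> q\<close> by (metis pmf_eqI)
  moreover have "pmf p x - pmf q x \<le> pmf p x * ln (pmf p x / pmf q x)" for x
    using strict[of x] by (cases "pmf p x = pmf q x") (auto simp: less_imp_le)
  ultimately have "(\<Sum>x\<in>UNIV. pmf p x - pmf q x) < KL p q"
    unfolding KL_def by (intro sum_strict_mono_ex1) (auto intro: strict)
  then show ?thesis
    by (simp add: sum_subtractf sum_pmf_UNIV)
qed

text \<open>The terms \<open>pmf p x * ln (pmf p x)\<close> cancel; what remains is the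
  cross-entropy of \<open>p\<close> relative to \<open>q\<close>.\<close>

lemma KL_plus_entropy:
  fixes p q :: "'a::finite pmf"
  assumes q: "set_pmf q = UNIV"
  shows "KL p q + shannon_entropy p = (\<Sum>x\<in>UNIV. pmf p x * ln (1 / pmf q x))"
proof -
  have "pmf p x * ln (pmf p x / pmf q x) - pmf p x * ln (pmf p x) = pmf p x * ln (1 / pmf q x)"
    for x
    using q pmf_positive[of x q] pmf_positive[of x p]
    by (cases "pmf p x = 0") (auto simp: ln_div set_pmf_iff algebra_simps)
  then show ?thesis
    by (simp add: KL_def shannon_entropy_def flip: sum_subtractf)
qed

text \<open>Chain rule: the log-ratio of \<open>P x\<close> to \<open>q\<close> splits at the law of
  \<open>Y\<close>, and averaging over the joint law of \<open>X\<close> and \<open>Y\<close> gives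
  the two summands.\<close>

lemma KL_bind_plus_mutual_info:
  fixes \<mu> q :: "'a::finite pmf"
  assumes q: "set_pmf q = UNIV"
  shows "KL (bind_pmf \<mu> P) q + mutual_info \<mu> P = (\<Sum>x\<in>UNIV. pmf \<mu> x * KL (P x) q)"
proof -
  let ?b = "pmf (bind_pmf \<mu> P)"
  have qpos: "pmf q x > 0" for x
    using q by (simp add: pmf_positive)
  have pointwise: "pmf \<mu> x * (pmf (P x) y * ln (?b y / pmf q y))
      + pmf \<mu> x * (pmf (P x) y * ln (pmf (P x) y / ?b y))
      = pmf \<mu> x * (pmf (P x) y * ln (pmf (P x) y / pmf q y))" for x y
  proof (cases "pmf \<mu> x = 0 \<or> pmf (P x) y = 0")
    case False
    then have "y \<in> set_pmf (bind_pmf \<mu> P)"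
      by (auto simp: set_pmf_iff)
    then have "?b y > 0" "pmf (P x) y > 0"
      using False by (auto simp: pmf_positive_iff set_pmf_iff)
    then show ?thesis using qpos[of y]
      by (simp add: ln_div algebra_simps)
  qed auto
  have "KL (bind_pmf \<mu> P) q
      = (\<Sum>y\<in>UNIV. \<Sum>x\<in>UNIV. pmf \<mu> x * (pmf (P x) y * ln (?b y / pmf q y)))"
    unfolding KL_def
    \<comment> \<open>Only the weight in front is expanded over \<open>x\<close>; the occurrence
      inside the logarithm stays.\<close>
    by (rule sum.cong[OF refl], subst (1) pmf_bind_finite)
      (simp add: sum_distrib_right mult.assoc)
  also have "\<dots> = (\<Sum>x\<in>UNIV. \<Sum>y\<in>UNIV. pmf \<mu> x * (pmf (P x) y * ln (?b y / pmf q y)))"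
    by (rule sum.swap)
  finally show ?thesis
    unfolding mutual_info_def KL_def[of "P _"]
    by (simp add: sum_distrib_left pointwise flip: sum.distrib)
qed

text \<open>A second point carries positive mass. This makes \<open>ln (1 / pmf q x)\<close>, the
  denominator of the retention ratio, strictly positive.\<close>

lemma pmf_less_1_of_full_support:
  fixes q :: "'a::finite pmf"
  assumes "CARD('a) \<ge> 2" and "set_pmf q = UNIV"
  shows "pmf q x < 1"
proof -
  have "UNIV \<noteq> {x}"
  proof
    assume "UNIV = {x}"
    then have "CARD('a) = card {x}" by simp
    then show False using assms(1) by simp
  qed
  then obtain y where "y \<noteq> x" by blast
  then have "pmf q x + pmf q y = sum (pmf q) {x, y}" by simp
  also have "\<dots> \<le> 1"
    unfolding sum_pmf_UNIV[of q, symmetric] by (rule sum_mono2) auto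
  finally show ?thesis
    using assms(2) pmf_positive[of y q] by simp
qed

theorem theorem7p4:
  fixes P :: "'a::finite \<Rightarrow> 'a pmf" and \<pi> \<mu> :: "'a pmf"
  assumes "CARD('a) \<ge> 2"
    and "bind_pmf \<pi> P = \<pi>"
    and "set_pmf \<pi> = UNIV"
    and "\<mu> \<noteq> \<pi>"
  shows "(KL (bind_pmf \<mu> P) \<pi> / KL \<mu> \<pi>
           \<le> max_kl_retention P \<pi> * ((KL \<mu> \<pi> + shannon_entropy \<mu>) / KL \<mu> \<pi>)
             - mutual_info \<mu> P / KL \<mu> \<pi>)
       \<and> (KL (bind_pmf \<mu> P) \<pi> / KL \<mu> \<pi>
           = max_kl_retention P \<pi> * ((KL \<mu> \<pi> + shannon_entropy \<mu>) / KL \<mu> \<pi>)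
             - mutual_info \<mu> P / KL \<mu> \<pi>
         \<longleftrightarrow> (\<forall>x\<in>set_pmf \<mu>. kl_retention P \<pi> x = max_kl_retention P \<pi>))"
proof -
  define D where "D = KL \<mu> \<pi>"
  define M where "M = max_kl_retention P \<pi>"
  define r where "r = kl_retention P \<pi>"
  define gap where "gap x = pmf \<mu> x * (ln (1 / pmf \<pi> x) * (M - r x))" for x
  have D: "D > 0"
    unfolding D_def using assms by (intro KL_pos)
  have L: "ln (1 / pmf \<pi> x) > 0" for x
    using pmf_less_1_of_full_support[OF assms(1,3), of x] assms(3) pmf_positive[of x \<pi>]
    by (intro ln_gt_zero) simp
  have rM: "r x \<le> M" for x
    unfolding r_def M_def max_kl_retention_def by (intro Max_ge) auto
  have gap_nonneg: "gap x \<ge> 0" for x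
    unfolding gap_def using less_imp_le[OF L[of x]] rM[of x] by simp
  have KL_P: "KL (P x) \<pi> = r x * ln (1 / pmf \<pi> x)" for x
    unfolding r_def kl_retention_def using L[of x] by simp
  have "M * (D + shannon_entropy \<mu>) - (KL (bind_pmf \<mu> P) \<pi> + mutual_info \<mu> P)
      = (\<Sum>x\<in>UNIV. gap x)"
    unfolding D_def KL_plus_entropy[OF assms(3)] KL_bind_plus_mutual_info[OF assms(3)]
    unfolding sum_distrib_left sum_subtractf[symmetric]
    by (rule sum.cong) (auto simp: KL_P gap_def algebra_simps)
  then have diff: "M * ((D + shannon_entropy \<mu>) / D) - mutual_info \<mu> P / D
      - KL (bind_pmf \<mu> P) \<pi> / D = (\<Sum>x\<in>UNIV. gap x) / D"
    using D by (simp add: field_simps)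
  have "(\<Sum>x\<in>UNIV. gap x) = 0 \<longleftrightarrow> (\<forall>x. gap x = 0)"
    using gap_nonneg by (simp add: sum_nonneg_eq_0_iff)
  also have "\<dots> \<longleftrightarrow> (\<forall>x\<in>set_pmf \<mu>. r x = M)"
  proof -
    \<comment> \<open>The logarithmic factor never vanishes, so a zero gap comes from the weight or
      from \<open>M - r x\<close>.\<close>
    have "gap x = 0 \<longleftrightarrow> (x \<in> set_pmf \<mu> \<longrightarrow> r x = M)" for x
      unfolding gap_def set_pmf_iff mult_eq_0_iff using L[of x] by linarith
    then show ?thesis by blast
  qed
  finally have zero: "(\<Sum>x\<in>UNIV. gap x) / D = 0 \<longleftrightarrow> (\<forall>x\<in>set_pmf \<mu>. r x = M)"
    using D by simp
  have "(\<Sum>x\<in>UNIV. gap x) / D \<ge> 0"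
    using D gap_nonneg by (simp add: sum_nonneg)
  with diff zero show ?thesis
    unfolding D_def[symmetric] M_def[symmetric] r_def[symmetric] by auto
qed

end
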